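(* (a) Let $f(x)\in R$ be monic and irreducible with nonzero constant coefficient $f_0$, and let $f^*(x)=F(x^n)$ be its bound, where $F\in\mathbb{K}[y]$ has degree $s$. If $\deg f=s\ell$ with $\ell=\ell_F$, then $$\mathrm{N}_{\mathbb{L}/\mathbb{K}}(f_0)=(-1)^{s\ell(n-1)}F_0^{\ell},$$ where $F_0$ is the constant coefficient of $F(x^n)$. (b) Let $F(y)\in\mathbb{K}[y]$ be monic irreducible of degree $s$, $F(y)\neq y$, and let $g(x)$ be a monic divisor of $F(x^n)$ in $R$ of degree $sh\ell$ for some $h\in\{1,\dots,m\}$, where $\ell=\ell_F$ and $m=m_F$. Then $$\mathrm{N}_{\mathbb{L}/\mathbb{K}}(g_0)=(-1)^{sh\ell(n-1)}F_0^{h\ell},$$ where $g_0$ and $F_0$ are the constant coefficients of $g(x)$ and $F(x^n)$.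
   Context: Let $\mathbb{K}$ be a field, $\mathbb{L}/\mathbb{K}$ a cyclic Galois extension of degree $n\ge2$, $\sigma$ a generator of $\mathrm{Gal}(\mathbb{L}/\mathbb{K})$, and $R=\mathbb{L}[x;\sigma]$ the skew polynomial ring with $xa=\sigma(a)x$ for $a\in\mathbb{L}$; its centre is $\mathbb{K}[x^n]$. The bound of a nonconstant $f\in R$ with nonzero constant coefficient is the unique $F(x^n)$, $F\in\mathbb{K}[y]$ monic, generating the largest two-sided ideal contained in $Rf$. For $F(y)\in\mathbb{K}[y]$ monic irreducible with $F(y)\ne y$, $m_F$ denotes the number of irreducible factors in a factorisation of $F(x^n)$ in $R$ (this number divides $n$), and $\ell_F=n/m_F$. $\mathrm{N}_{\mathbb{L}/\mathbb{K}}$ is the field norm. *)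

theory Defs
  imports Complex_Main "HOL-Computational_Algebra.Polynomial" "HOL-Algebra.Ideal"
begin

text \<open>
  A field extension L/K is a homomorphism \<open>\<iota>\<close> between two types of class \<open>field\<close>.
  The skew polynomial ring is a record, since it depends on the value \<open>\<sigma>\<close>.
\<close>

definition field_embedding :: "('k::field \<Rightarrow> 'l::field) \<Rightarrow> bool" where
  "field_embedding \<iota> \<longleftrightarrow>
     \<iota> 1 = 1 \<and> (\<forall>a b. \<iota> (a + b) = \<iota> a + \<iota> b) \<and> (\<forall>a b. \<iota> (a * b) = \<iota> a * \<iota> b)"

definition extension_degree :: "('k::field \<Rightarrow> 'l::field) \<Rightarrow> nat" where
  "extension_degree \<iota> = vector_space.dim (\<lambda>c v. \<iota> c * v) (UNIV :: 'l set)"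

definition Gal :: "('k::field \<Rightarrow> 'l::field) \<Rightarrow> ('l \<Rightarrow> 'l) set" where
  "Gal \<iota> = {\<tau>. field_embedding \<tau> \<and> bij \<tau> \<and> (\<forall>c. \<tau> (\<iota> c) = \<iota> c)}"

text \<open>
  The library's \<open>dim\<close> of an infinite-dimensional space is 0, so \<open>n > 0\<close> makes the extension
  finite. It is Galois if K is the fixed field of its automorphism group. That group is then
  finite, so the natural powers of \<open>\<sigma>\<close> exhaust the subgroup generated by \<open>\<sigma>\<close>.
\<close>
definition cyclic_galois_extension ::
  "('k::field \<Rightarrow> 'l::field) \<Rightarrow> ('l \<Rightarrow> 'l) \<Rightarrow> nat \<Rightarrow> bool" where
  "cyclic_galois_extension \<iota> \<sigma> n \<longleftrightarrow>
     field_embedding \<iota> \<and> n > 0 \<and> extension_degree \<iota> = n \<and>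
     {a. \<forall>\<tau>\<in>Gal \<iota>. \<tau> a = a} = range \<iota> \<and>
     Gal \<iota> = range (\<lambda>i. \<sigma> ^^ i)"

text \<open>The norm of a Galois extension, with values in the image of K in L.\<close>
definition galois_norm :: "('k::field \<Rightarrow> 'l::field) \<Rightarrow> 'l \<Rightarrow> 'l" where
  "galois_norm \<iota> a = (\<Prod>\<tau>\<in>Gal \<iota>. \<tau> a)"

text \<open>
  The polynomial \<open>\<Sum>i. a\<^sub>i x\<^sup>i\<close> with coefficients on the left represents an element of \<open>L[x;\<sigma>]\<close>,
  where \<open>x a = \<sigma>(a) x\<close>. Only the additive structure of the library's polynomials is used.
\<close>
definition skew_mult :: "('l::field \<Rightarrow> 'l) \<Rightarrow> 'l poly \<Rightarrow> 'l poly \<Rightarrow> 'l poly" where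
  "skew_mult \<sigma> f g =
     (\<Sum>i\<le>degree f. \<Sum>j\<le>degree g. monom (coeff f i * (\<sigma> ^^ i) (coeff g j)) (i + j))"

definition skew_ring :: "('l::field \<Rightarrow> 'l) \<Rightarrow> 'l poly ring" where
  "skew_ring \<sigma> = \<lparr>carrier = UNIV, mult = skew_mult \<sigma>, one = 1, zero = 0, add = (+)\<rparr>"

definition skew_irreducible :: "('l::field \<Rightarrow> 'l) \<Rightarrow> 'l poly \<Rightarrow> bool" where
  "skew_irreducible \<sigma> f \<longleftrightarrow>
     f \<noteq> 0 \<and> f \<notin> Units (skew_ring \<sigma>) \<and>
     (\<forall>g h. f = skew_mult \<sigma> g h \<longrightarrow> g \<in> Units (skew_ring \<sigma>) \<or> h \<in> Units (skew_ring \<sigma>))"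

definition skew_divisor :: "('l::field \<Rightarrow> 'l) \<Rightarrow> 'l poly \<Rightarrow> 'l poly \<Rightarrow> bool" where
  "skew_divisor \<sigma> g P \<longleftrightarrow> (\<exists>q. P = skew_mult \<sigma> q g \<or> P = skew_mult \<sigma> g q)"

text \<open>The element \<open>F(x\<^sup>n)\<close> of \<open>L[x;\<sigma>]\<close>.\<close>
definition subst_xn :: "('k::field \<Rightarrow> 'l::field) \<Rightarrow> nat \<Rightarrow> 'k poly \<Rightarrow> 'l poly" where
  "subst_xn \<iota> n F = (\<Sum>i\<le>degree F. monom (\<iota> (coeff F i)) (n * i))"

text \<open>\<open>F(x\<^sup>n)\<close> is the bound of \<open>f\<close>.\<close>
definition is_bound ::
  "('k::field \<Rightarrow> 'l::field) \<Rightarrow> ('l \<Rightarrow> 'l) \<Rightarrow> nat \<Rightarrow> 'l poly \<Rightarrow> 'k poly \<Rightarrow> bool" where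
  "is_bound \<iota> \<sigma> n f F \<longleftrightarrow>
     (let R = skew_ring \<sigma>;
          Rf = range (\<lambda>r. skew_mult \<sigma> r f);
          J = genideal R {subst_xn \<iota> n F}
      in lead_coeff F = 1 \<and> J \<subseteq> Rf \<and> (\<forall>I. ideal I R \<and> I \<subseteq> Rf \<longrightarrow> I \<subseteq> J))"

definition skew_factorisation :: "('l::field \<Rightarrow> 'l) \<Rightarrow> 'l poly \<Rightarrow> 'l poly list \<Rightarrow> bool" where
  "skew_factorisation \<sigma> P fs \<longleftrightarrow>
     (\<forall>f\<in>set fs. skew_irreducible \<sigma> f) \<and> foldr (skew_mult \<sigma>) fs 1 = P"

text \<open>
  The number of factors is unique by the Jordan--Hoelder theorem, since \<open>L[x;\<sigma>]\<close> is a
  principal left ideal domain.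
\<close>
definition num_factors ::
  "('k::field \<Rightarrow> 'l::field) \<Rightarrow> ('l \<Rightarrow> 'l) \<Rightarrow> nat \<Rightarrow> 'k poly \<Rightarrow> nat" where
  "num_factors \<iota> \<sigma> n F =
     (THE m. \<exists>fs. skew_factorisation \<sigma> (subst_xn \<iota> n F) fs \<and> length fs = m)"

text \<open>The division is exact for monic irreducible \<open>F \<noteq> y\<close>.\<close>
definition ell :: "('k::field \<Rightarrow> 'l::field) \<Rightarrow> ('l \<Rightarrow> 'l) \<Rightarrow> nat \<Rightarrow> 'k poly \<Rightarrow> nat" where
  "ell \<iota> \<sigma> n F = n div num_factors \<iota> \<sigma> n F"

end

theory Submission
  imports Defs "HOL-Number_Theory.Cong" "HOL-Computational_Algebra.Formal_Power_Series"
    "Jordan_Normal_Form.Char_Poly"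
begin

text \<open>
  Right multiplication by \<open>f\<close> on the free \<open>L[x\<^sup>n]\<close>-module \<open>L[x;\<sigma>]\<close> has a determinant, the reduced
  norm of \<open>f\<close>. It is multiplicative, lies in \<open>K[x\<^sup>n]\<close> and equals \<open>F(x\<^sup>n)\<^sup>n\<close> for \<open>f = F(x\<^sup>n)\<close>. Its
  constant coefficient is the field norm of \<open>f\<^sub>0\<close>, and for monic \<open>f\<close> its leading coefficient
  is the determinant of a power of the cyclic permutation matrix. The reduced norm of a divisor of
  \<open>F(x\<^sup>n)\<close> therefore divides a power of \<open>F\<close>, so it is \<open>c F\<^sup>k\<close> when \<open>F\<close> is irreducible. The degree
  determines \<open>k\<close>, the leading coefficient determines \<open>c\<close>, and the constant coefficients are compared.
  The bound of an irreducible \<open>f\<close> is irreducible because the left ideal generated by \<open>f\<close> is maximal.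
\<close>

section \<open>Skew polynomials\<close>

locale twisted_field =
  fixes \<sigma> :: "'l::field \<Rightarrow> 'l"
  assumes field_embedding: "field_embedding \<sigma>"
begin

lemma sigma_one [simp]: "\<sigma> 1 = 1"
  and sigma_add: "\<sigma> (a + b) = \<sigma> a + \<sigma> b"
  and sigma_mult: "\<sigma> (a * b) = \<sigma> a * \<sigma> b"
  using field_embedding by (auto simp: field_embedding_def)

sublocale hom: field_hom \<sigma>
proof
  have "\<sigma> 0 + \<sigma> 0 = \<sigma> 0 + 0" using sigma_add[of 0 0] by simp
  then show "\<sigma> 0 = 0" by (rule add_left_imp_eq)
qed (simp_all add: sigma_add sigma_mult)

sublocale pow: field_hom "\<sigma> ^^ i"
proof (unfold_locales, goal_cases)
  case 1 show ?case by (induction i) simp_all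
next
  case (2 x y) show ?case by (induction i) (simp_all add: sigma_add)
next
  case 3 show ?case by (induction i) simp_all
next
  case (4 x y) show ?case by (induction i) (simp_all add: sigma_mult)
qed

text \<open>Coefficients vanish beyond the degree, so the convolution can run up to \<open>m\<close>
  alone. Identities between skew products are then checked coefficient by coefficient.\<close>

lemma coeff_skew_mult:
  "coeff (skew_mult \<sigma> f g) m = (\<Sum>i\<le>m. coeff f i * (\<sigma> ^^ i) (coeff g (m - i)))"
proof -
  let ?c = "\<lambda>i j. coeff f i * (\<sigma> ^^ i) (coeff g j)"
  have "coeff (skew_mult \<sigma> f g) m =
      (\<Sum>i\<le>degree f. \<Sum>j\<le>degree g. if i + j = m then ?c i j else 0)"
    by (simp add: skew_mult_def coeff_sum)
  also have "\<dots> = (\<Sum>i\<le>degree f. if i \<le> m then ?c i (m - i) else 0)"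
  proof (rule sum.cong[OF refl])
    fix i
    have "(\<Sum>j\<le>degree g. if i + j = m then ?c i j else 0) =
        (\<Sum>j\<le>degree g. if j = m - i then (if i \<le> m then ?c i j else 0) else 0)"
      by (rule sum.cong) auto
    also have "\<dots> = (if i \<le> m then ?c i (m - i) else 0)"
      by (auto simp: sum.delta' coeff_eq_0)
    finally show "(\<Sum>j\<le>degree g. if i + j = m then ?c i j else 0) = \<dots>" .
  qed
  also have "\<dots> = (\<Sum>i\<le>max m (degree f). if i \<le> m then ?c i (m - i) else 0)"
    by (rule sum.mono_neutral_left) (auto simp: coeff_eq_0)
  also have "\<dots> = (\<Sum>i\<le>m. ?c i (m - i))"
    by (rule sum.mono_neutral_cong_right) auto
  finally show ?thesis .
qed

text \<open>Both sides sum \<open>f_i \<sigma>^i(g_k) \<sigma>^(i+k)(h_l)\<close> over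
  \<open>i + k + l = m\<close>; writing \<open>i + (j - i)\<close> for \<open>j\<close> gives the
  form that the regrouping lemma for formal power series expects.\<close>

lemma skew_mult_assoc:
  "skew_mult \<sigma> (skew_mult \<sigma> f g) h = skew_mult \<sigma> f (skew_mult \<sigma> g h)"
proof (rule poly_eqI)
  fix m
  have "coeff (skew_mult \<sigma> (skew_mult \<sigma> f g) h) m =
      (\<Sum>j=0..m. \<Sum>i=0..j. coeff f i * (\<sigma> ^^ i) (coeff g (j - i)) *
        (\<sigma> ^^ (i + (j - i))) (coeff h (m - j)))"
    by (auto simp: coeff_skew_mult sum_distrib_right atMost_atLeast0 intro!: sum.cong)
  also have "\<dots> = (\<Sum>j=0..m. \<Sum>i=0..m - j. coeff f j * (\<sigma> ^^ j) (coeff g i) *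
      (\<sigma> ^^ (j + i)) (coeff h (m - j - i)))"
    by (rule fps_mult_assoc_lemma
        [of "\<lambda>i k l. coeff f i * (\<sigma> ^^ i) (coeff g k) * (\<sigma> ^^ (i + k)) (coeff h l)"])
  also have "\<dots> = coeff (skew_mult \<sigma> f (skew_mult \<sigma> g h)) m"
    by (simp add: coeff_skew_mult sum_distrib_left atMost_atLeast0 pow.hom_sum pow.hom_mult
        funpow_add mult.assoc)
  finally show "coeff (skew_mult \<sigma> (skew_mult \<sigma> f g) h) m = \<dots>" .
qed

lemma skew_mult_add_left:
  "skew_mult \<sigma> (f + g) h = skew_mult \<sigma> f h + skew_mult \<sigma> g h"
  by (rule poly_eqI) (simp add: coeff_skew_mult algebra_simps sum.distrib)

lemma skew_mult_add_right:
  "skew_mult \<sigma> f (g + h) = skew_mult \<sigma> f g + skew_mult \<sigma> f h"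
  by (rule poly_eqI) (simp add: coeff_skew_mult pow.hom_add algebra_simps sum.distrib)

lemma skew_mult_uminus_left: "skew_mult \<sigma> (- f) g = - skew_mult \<sigma> f g"
  by (rule poly_eqI) (simp add: coeff_skew_mult sum_negf)

lemma skew_mult_diff_left:
  "skew_mult \<sigma> (f - g) h = skew_mult \<sigma> f h - skew_mult \<sigma> g h"
  using skew_mult_add_left[of f "- g" h] by (simp add: skew_mult_uminus_left)

lemma skew_mult_0_left [simp]: "skew_mult \<sigma> 0 f = 0"
  and skew_mult_0_right [simp]: "skew_mult \<sigma> f 0 = 0"
  by (simp_all add: skew_mult_def)

lemma skew_mult_const_left: "skew_mult \<sigma> [:c:] f = Polynomial.smult c f"
proof (rule poly_eqI)
  fix m
  have "coeff (skew_mult \<sigma> [:c:] f) m = (\<Sum>i\<le>m. if i = 0 then c * coeff f m else 0)"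
    unfolding coeff_skew_mult by (rule sum.cong) (auto simp: coeff_pCons split: nat.split)
  then show "coeff (skew_mult \<sigma> [:c:] f) m = coeff (Polynomial.smult c f) m"
    by simp
qed

lemma skew_mult_1_left [simp]: "skew_mult \<sigma> 1 f = f"
  using skew_mult_const_left[of 1 f] by (simp add: one_pCons)

lemma skew_mult_1_right [simp]: "skew_mult \<sigma> f 1 = f"
proof (rule poly_eqI)
  fix m
  have "coeff (skew_mult \<sigma> f 1) m = (\<Sum>i\<le>m. if i = m then coeff f m else 0)"
    unfolding coeff_skew_mult by (rule sum.cong) auto
  then show "coeff (skew_mult \<sigma> f 1) m = coeff f m"
    by simp
qed

lemma ring_skew_ring: "ring (skew_ring \<sigma>)"
proof (rule ringI)
  show "abelian_group (skew_ring \<sigma>)"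
  proof (rule abelian_groupI)
    fix x assume "x \<in> carrier (skew_ring \<sigma>)"
    show "\<exists>y\<in>carrier (skew_ring \<sigma>). y \<oplus>\<^bsub>skew_ring \<sigma>\<^esub> x = \<zero>\<^bsub>skew_ring \<sigma>\<^esub>"
      by (rule bexI[of _ "- x"]) (simp_all add: skew_ring_def)
  qed (simp_all add: skew_ring_def algebra_simps)
  show "Group.monoid (skew_ring \<sigma>)"
    by (rule Group.monoidI) (simp_all add: skew_ring_def skew_mult_assoc)
qed (simp_all add: skew_ring_def skew_mult_add_left skew_mult_add_right)

lemma coeff_skew_mult_degree:
  "coeff (skew_mult \<sigma> f g) (degree f + degree g) =
     lead_coeff f * (\<sigma> ^^ degree f) (lead_coeff g)"
proof -
  have "coeff (skew_mult \<sigma> f g) (degree f + degree g) =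
      (\<Sum>i\<le>degree f + degree g. if i = degree f
        then lead_coeff f * (\<sigma> ^^ degree f) (lead_coeff g) else 0)"
    unfolding coeff_skew_mult
  proof (rule sum.cong[OF refl])
    fix i
    show "coeff f i * (\<sigma> ^^ i) (coeff g (degree f + degree g - i)) =
        (if i = degree f then lead_coeff f * (\<sigma> ^^ degree f) (lead_coeff g) else 0)"
      by (cases i "degree f" rule: linorder_cases) (simp_all add: coeff_eq_0)
  qed
  then show ?thesis by simp
qed

lemma degree_skew_mult_le: "degree (skew_mult \<sigma> f g) \<le> degree f + degree g"
proof (rule degree_le, intro allI impI)
  fix m assume "degree f + degree g < m"
  then have "degree f < i \<or> degree g < m - i" for i by linarith
  then have "coeff f i = 0 \<or> coeff g (m - i) = 0" for i
    by (meson coeff_eq_0)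
  then have "coeff f i * (\<sigma> ^^ i) (coeff g (m - i)) = 0" for i
    by (metis mult_eq_0_iff pow.hom_zero)
  then show "coeff (skew_mult \<sigma> f g) m = 0"
    unfolding coeff_skew_mult by (simp del: mult_eq_0_iff)
qed

text \<open>Powers of \<open>\<sigma>\<close> are injective, so the product of the leading terms is
  nonzero.\<close>

lemma degree_skew_mult:
  assumes "f \<noteq> 0" "g \<noteq> 0"
  shows "degree (skew_mult \<sigma> f g) = degree f + degree g"
proof (rule antisym[OF degree_skew_mult_le le_degree])
  show "coeff (skew_mult \<sigma> f g) (degree f + degree g) \<noteq> 0"
    using assms by (simp add: coeff_skew_mult_degree)
qed

lemma skew_unitI: "c \<noteq> 0 \<Longrightarrow> [:c:] \<in> Units (skew_ring \<sigma>)"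
  unfolding Units_def
  by (auto simp: skew_ring_def skew_mult_const_left one_pCons intro!: exI[of _ "[:inverse c:]"])

text \<open>Euclidean division with the quotient on the left, by cancelling leading terms. It makes
  left ideals principal.\<close>

lemma skew_division:
  assumes "f \<noteq> 0"
  shows "\<exists>q r. g = skew_mult \<sigma> q f + r \<and> (r = 0 \<or> degree r < degree f)"
proof (induction "degree g" arbitrary: g rule: less_induct)
  case less
  show ?case
  proof (cases "g = 0 \<or> degree g < degree f")
    case True
    then show ?thesis by (intro exI[of _ 0] exI[of _ g]) simp
  next
    case False
    define k where "k = degree g - degree f"
    \<comment> \<open>Moving \<open>x^k\<close> past the leading coefficient of \<open>f\<close>
      applies \<open>\<sigma> ^^ k\<close> to it, hence the twisted denominator.\<close>
    define c where "c = lead_coeff g / (\<sigma> ^^ k) (lead_coeff f)"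
    have nz: "c \<noteq> 0" using assms False by (simp add: c_def)
    have deg: "degree (monom c k) = k" using nz by (simp add: degree_monom_eq)
    define h where "h = g - skew_mult \<sigma> (monom c k) f"
    have k: "k + degree f = degree g" using False by (simp add: k_def)
    have "coeff (skew_mult \<sigma> (monom c k) f) (degree g) = lead_coeff g"
      using coeff_skew_mult_degree[of "monom c k" f] assms nz unfolding deg k
      by (simp add: c_def)
    then have top: "coeff h (degree g) = 0" by (simp add: h_def)
    have "degree h \<le> degree g"
      using degree_skew_mult_le[of "monom c k" f] unfolding h_def deg k
      by (intro degree_diff_le) simp_all
    with top have "h = 0 \<or> degree h < degree g"
      by (metis eq_zero_or_degree_less)
    then obtain q r where "h = skew_mult \<sigma> q f + r" "r = 0 \<or> degree r < degree f"
      using less(1)[of h] by (metis add.right_neutral skew_mult_0_left)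
    then have "g = skew_mult \<sigma> (q + monom c k) f + r \<and> (r = 0 \<or> degree r < degree f)"
      by (simp add: h_def skew_mult_add_left algebra_simps)
    then show ?thesis by blast
  qed
qed

end

section \<open>Cyclic extensions\<close>

text \<open>The relation at \<open>y * x\<close> minus \<open>\<chi> k y\<close> times the relation
  at \<open>x\<close> has no \<open>k\<close> term, so induction kills each
  \<open>c j * (\<chi> j y - \<chi> k y)\<close>. A nonzero \<open>c j\<close> would then make
  \<open>\<chi> j\<close> and \<open>\<chi> k\<close> equal.\<close>

lemma dedekind_independence:
  fixes \<chi> :: "'j \<Rightarrow> 'l::field \<Rightarrow> 'm::field"
  assumes "finite J" "inj_on \<chi> J" "\<And>j. j \<in> J \<Longrightarrow> field_embedding (\<chi> j)"
    and "\<And>x. (\<Sum>j\<in>J. c j * \<chi> j x) = 0" "j \<in> J"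
  shows "c j = 0"
  using assms
proof (induction J arbitrary: c j rule: finite_induct)
  case empty
  then show ?case by simp
next
  case (insert k J)
  have mult: "\<chi> i (x * y) = \<chi> i x * \<chi> i y" and one: "\<chi> i 1 = 1" if "i \<in> insert k J" for i x y
    using insert.prems(2)[OF that] by (auto simp: field_embedding_def)
  have 0: "c k * \<chi> k x + (\<Sum>j\<in>J. c j * \<chi> j x) = 0" for x
    using insert.prems(3)[of x] insert.hyps by simp
  have J: "c i = 0" if "i \<in> J" for i
  proof (rule ccontr)
    assume nz: "c i \<noteq> 0"
    have "\<chi> i y = \<chi> k y" for y
    proof -
      have "(\<Sum>j\<in>J. c j * (\<chi> j y - \<chi> k y) * \<chi> j x) = 0" for x
      proof -
        have "(\<Sum>j\<in>J. c j * (\<chi> j y - \<chi> k y) * \<chi> j x) =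
            (\<Sum>j\<in>J. c j * \<chi> j (y * x)) - \<chi> k y * (\<Sum>j\<in>J. c j * \<chi> j x)"
          by (simp add: sum_distrib_left sum_subtractf[symmetric] mult algebra_simps)
        also have "\<dots> = (c k * \<chi> k (y * x) + (\<Sum>j\<in>J. c j * \<chi> j (y * x)))
            - \<chi> k y * (c k * \<chi> k x + (\<Sum>j\<in>J. c j * \<chi> j x))"
          by (simp add: mult algebra_simps)
        finally show ?thesis by (simp add: 0)
      qed
      then have "c i * (\<chi> i y - \<chi> k y) = 0"
        using insert.IH[of "\<lambda>j. c j * (\<chi> j y - \<chi> k y)" i] insert.prems that
        by (auto simp: inj_on_def)
      with nz show ?thesis by simp
    qed
    then have "\<chi> i = \<chi> k" by blast
    with insert.prems(1) that have "i = k" by (auto simp: inj_on_def)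
    with that insert.hyps show False by simp
  qed
  then have "c k = 0" using 0[of 1] one[of k] by simp
  with J insert.prems(4) show ?case by auto
qed

text \<open>Gaussian elimination: a row that vanishes on \<open>J\<close> is dropped, any other row
  eliminates one unknown.\<close>

lemma homogeneous_system_nontrivial_solution:
  fixes a :: "'i \<Rightarrow> 'j \<Rightarrow> 'l::field"
  assumes "finite I" "finite J" "card I < card J"
  shows "\<exists>c. (\<exists>j\<in>J. c j \<noteq> 0) \<and> (\<forall>i\<in>I. (\<Sum>j\<in>J. a i j * c j) = 0)"
  using assms
proof (induction I arbitrary: J a rule: finite_induct)
  case empty
  then obtain j where "j \<in> J" by fastforce
  then show ?case by (intro exI[of _ "\<lambda>_. 1"]) auto
next
  case (insert k I)
  show ?case
  proof (cases "\<forall>j\<in>J. a k j = 0")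
    case True
    have "card I < card J" using insert by simp
    then obtain c where "\<exists>j\<in>J. c j \<noteq> 0" "\<forall>i\<in>I. (\<Sum>j\<in>J. a i j * c j) = 0"
      using insert.IH[of J a] insert.prems by blast
    then show ?thesis using True by (intro exI[of _ c]) auto
  next
    case False
    then obtain p where p: "p \<in> J" "a k p \<noteq> 0" by blast
    define J' where "J' = J - {p}"
    have J: "J = insert p J'" "p \<notin> J'" "finite J'"
      using p insert.prems by (auto simp: J'_def)
    \<comment> \<open>The rows after clearing column \<open>p\<close> with the pivot
      \<open>a k p\<close>; the value at \<open>p\<close> is restored in \<open>d\<close> from
      equation \<open>k\<close>.\<close>
    define a' where "a' i j = a i j - a i p * a k j / a k p" for i j
    have "card I < card J'" using insert J by simp
    then obtain c where c: "\<exists>j\<in>J'. c j \<noteq> 0" "\<And>i. i \<in> I \<Longrightarrow> (\<Sum>j\<in>J'. a' i j * c j) = 0"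
      using insert.IH[of J' a'] J by blast
    define s where "s = (\<Sum>j\<in>J'. a k j * c j)"
    define d where "d = c(p := - s / a k p)"
    have d: "(\<Sum>j\<in>J. a i j * d j) = (\<Sum>j\<in>J'. a i j * c j) - a i p * s / a k p" for i
    proof -
      have "(\<Sum>j\<in>J'. a i j * d j) = (\<Sum>j\<in>J'. a i j * c j)"
        using J by (intro sum.cong) (auto simp: d_def)
      then show ?thesis using J by (simp add: d_def)
    qed
    have "(\<Sum>j\<in>J. a i j * d j) = (\<Sum>j\<in>J'. a' i j * c j)" for i
      unfolding d by (simp add: a'_def s_def sum_subtractf sum_distrib_left sum_divide_distrib
          algebra_simps)
    with c have "\<forall>i\<in>I. (\<Sum>j\<in>J. a i j * d j) = 0" by simp
    moreover have "(\<Sum>j\<in>J. a k j * d j) = 0" unfolding d using p by (simp add: s_def)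
    moreover have "\<exists>j\<in>J. d j \<noteq> 0" using c(1) J by (auto simp: d_def)
    ultimately show ?thesis by (intro exI[of _ d]) auto
  qed
qed

text \<open>A set of positive cardinality is finite, so \<open>n > 0\<close> turns the dimension
  into a finite basis with explicit coordinates \<open>u\<close>.\<close>

lemma extension_basis:
  fixes \<iota> :: "'k::field \<Rightarrow> 'l::field"
  assumes "field_embedding \<iota>" "extension_degree \<iota> = n" "n > 0"
  obtains B where "finite B" "card B = n"
    and "\<And>x. \<exists>u. x = (\<Sum>b\<in>B. \<iota> (u b) * b)"
    and "\<And>u b. (\<Sum>b\<in>B. \<iota> (u b) * b) = 0 \<Longrightarrow> b \<in> B \<Longrightarrow> u b = 0"
proof -
  interpret vs: vector_space "\<lambda>c v. \<iota> c * v"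
    using assms(1) by unfold_locales (auto simp: field_embedding_def algebra_simps)
  obtain B where B: "vs.independent B" "UNIV \<subseteq> vs.span B" "card B = vs.dim UNIV"
    using vs.basis_exists by metis
  have card: "card B = n" using B(3) assms(2) by (simp add: extension_degree_def)
  have fin: "finite B" using card assms(3) by (intro card_ge_0_finite) simp
  have "\<exists>u. x = (\<Sum>b\<in>B. \<iota> (u b) * b)" for x
    using B(2) vs.span_finite[OF fin] by blast
  moreover have "(\<Sum>b\<in>B. \<iota> (u b) * b) = 0 \<Longrightarrow> b \<in> B \<Longrightarrow> u b = 0" for u b
    using vs.independentD[OF B(1) fin] by blast
  ultimately show thesis using that fin card by blast
qed

lemma field_embedding_funpow:
  fixes \<sigma> :: "'l::field \<Rightarrow> 'l"
  shows "field_embedding \<sigma> \<Longrightarrow> field_embedding (\<sigma> ^^ i)"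
  by (induction i) (auto simp: field_embedding_def)

text \<open>What the reduced norm uses of the Galois hypothesis, expressed through
  \<open>\<sigma>\<close> instead of the group.\<close>

locale cyclic_extension = twisted_field \<sigma>
  for \<iota> :: "'k::field \<Rightarrow> 'l::field" and \<sigma> :: "'l \<Rightarrow> 'l" and n :: nat +
  assumes n_pos: "n > 0"
    and iota: "field_embedding \<iota>"
    and sigma_iota [simp]: "\<sigma> (\<iota> c) = \<iota> c"
    and sigma_fixedD: "\<sigma> a = a \<Longrightarrow> a \<in> range \<iota>"
    and sigma_order: "\<sigma> ^^ n = id"
    and galois_norm_eq: "galois_norm \<iota> a = (\<Prod>i<n. (\<sigma> ^^ i) a)"

text \<open>The point is that the order \<open>N\<close> of \<open>\<sigma>\<close> equals the
  degree \<open>n\<close>. Dedekind independence gives \<open>N \<le> n\<close>, a trace argument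
  the converse.\<close>

lemma cyclic_extensionI:
  fixes \<iota> :: "'k::field \<Rightarrow> 'l::field"
  assumes "cyclic_galois_extension \<iota> \<sigma> n"
  shows "cyclic_extension \<iota> \<sigma> n"
proof -
  have emb: "field_embedding \<iota>" and n: "n > 0" and deg: "extension_degree \<iota> = n"
    and fixed_field: "{a. \<forall>\<tau>\<in>Gal \<iota>. \<tau> a = a} = range \<iota>"
    and Gal: "Gal \<iota> = range (\<lambda>i. \<sigma> ^^ i)"
    using assms unfolding cyclic_galois_extension_def by blast+
  have "\<sigma> ^^ 1 \<in> Gal \<iota>" unfolding Gal by blast
  then have \<sigma>: "field_embedding \<sigma>" "bij \<sigma>" "\<And>c. \<sigma> (\<iota> c) = \<iota> c"
    by (auto simp: Gal_def)
  interpret twisted_field \<sigma> using \<sigma>(1) by unfold_locales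
  have fixed: "a \<in> range \<iota>" if "\<sigma> a = a" for a
  proof -
    have "(\<sigma> ^^ i) a = a" for i using that by (induction i) auto
    then show ?thesis using fixed_field Gal by auto
  qed
  have pow_iota: "(\<sigma> ^^ i) (\<iota> c) = \<iota> c" for i c using \<sigma>(3) by (induction i) auto
  have cancel: "\<sigma> ^^ (j - i) = id" if "\<sigma> ^^ i = \<sigma> ^^ j" "i \<le> j" for i j
  proof -
    have "inj (\<sigma> ^^ i)" using \<sigma>(2) by (simp add: bij_is_inj inj_fn)
    moreover have "(\<sigma> ^^ i) ((\<sigma> ^^ (j - i)) x) = (\<sigma> ^^ i) x" for x
      using that by (metis comp_apply funpow_add le_add_diff_inverse)
    ultimately show ?thesis by (auto simp: inj_def)
  qed
  obtain B where B: "finite B" "card B = n"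
    and span: "\<And>x. \<exists>u. x = (\<Sum>b\<in>B. \<iota> (u b) * b)"
    and indep: "\<And>u b. (\<Sum>b\<in>B. \<iota> (u b) * b) = 0 \<Longrightarrow> b \<in> B \<Longrightarrow> u b = 0"
    using extension_basis[OF emb deg n] by metis
  have "\<exists>i>0. i \<le> n \<and> \<sigma> ^^ i = id"
  proof (rule ccontr)
    assume none: "\<not> ?thesis"
    have inj: "inj_on (\<lambda>i. \<sigma> ^^ i) {..n}"
    proof (rule linorder_inj_onI)
      fix i j assume ij: "i < j" "j \<in> {..n}"
      then have "j - i > 0" "j - i \<le> n" by auto
      with none have "\<sigma> ^^ (j - i) \<noteq> id" by blast
      with ij cancel[of i j] show "\<sigma> ^^ i \<noteq> \<sigma> ^^ j" by auto
    qed auto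
    \<comment> \<open>There are \<open>n\<close> equations, one per basis element, in
      \<open>n + 1\<close> unknowns. By K-linearity the resulting relation between powers of
      \<open>\<sigma>\<close> holds on all of L.\<close>
    obtain c j where c: "j \<in> {..n}" "c j \<noteq> 0"
      "\<forall>b\<in>B. (\<Sum>j\<le>n. (\<sigma> ^^ j) b * c j) = 0"
      using homogeneous_system_nontrivial_solution[of B "{..n}" "\<lambda>b j. (\<sigma> ^^ j) b"] B by auto
    have "(\<Sum>j\<le>n. c j * (\<sigma> ^^ j) x) = 0" for x
    proof -
      obtain u where x: "x = (\<Sum>b\<in>B. \<iota> (u b) * b)" using span by blast
      have "(\<Sum>j\<le>n. c j * (\<sigma> ^^ j) x) = (\<Sum>j\<le>n. \<Sum>b\<in>B. \<iota> (u b) * ((\<sigma> ^^ j) b * c j))"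
        unfolding x
        by (simp add: pow.hom_sum pow.hom_mult pow_iota sum_distrib_left mult_ac)
      also have "\<dots> = (\<Sum>b\<in>B. \<iota> (u b) * (\<Sum>j\<le>n. (\<sigma> ^^ j) b * c j))"
        by (subst sum.swap) (simp add: sum_distrib_left)
      finally show ?thesis using c(3) by simp
    qed
    with dedekind_independence[OF _ inj, of c j] c(1) field_embedding_funpow[OF \<sigma>(1)]
    have "c j = 0" by blast
    with c(2) show False by contradiction
  qed
  then have ex: "\<exists>i. i > 0 \<and> \<sigma> ^^ i = id" by blast
  define N where "N = (LEAST i. i > 0 \<and> \<sigma> ^^ i = id)"
  have N: "N > 0" "\<sigma> ^^ N = id" using LeastI_ex[OF ex] by (auto simp: N_def)
  have least: "N \<le> i" if "i > 0" "\<sigma> ^^ i = id" for i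
    unfolding N_def using that by (intro Least_le) auto
  have inj: "inj_on (\<lambda>i. \<sigma> ^^ i) {..<N}"
  proof (rule linorder_inj_onI)
    fix i j assume "i < j" "j \<in> {..<N}"
    then show "\<sigma> ^^ i \<noteq> \<sigma> ^^ j" using cancel[of i j] least[of "j - i"] by auto
  qed auto
  have "n \<le> N"
    \<comment> \<open>A nontrivial solution \<open>c\<close> of \<open>\<Sum>b\<in>B. \<sigma>\<^sup>j(b) c(b) = 0\<close> for \<open>j < N\<close> gives \<open>\<Sum>b\<in>B. tr(y c(b)) b = 0\<close>
      for all \<open>y\<close>. The traces lie in \<open>K\<close>, so they vanish, against the independence of the \<open>\<sigma>\<^sup>k\<close>.\<close>
  proof (rule ccontr)
    assume "\<not> n \<le> N"
    then obtain c b0 where c: "b0 \<in> B" "c b0 \<noteq> 0"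
      "\<forall>j\<in>{..<N}. (\<Sum>b\<in>B. (\<sigma> ^^ j) b * c b) = 0"
      using homogeneous_system_nontrivial_solution[of "{..<N}" B "\<lambda>j b. (\<sigma> ^^ j) b"] B by auto
    define tr where "tr x = (\<Sum>k<N. (\<sigma> ^^ k) x)" for x
    have "tr x \<in> range \<iota>" for x
    proof (rule fixed)
      \<comment> \<open>With the last summand split off, \<open>\<sigma>\<close> is seen to cycle
        the terms of the trace: \<open>(\<sigma> ^^ N) x = x\<close> returns as the first
        one.\<close>
      obtain M where M: "N = Suc M" using N(1) gr0_implies_Suc by blast
      have "\<sigma> (tr x) = (\<Sum>k<M. (\<sigma> ^^ Suc k) x) + (\<sigma> ^^ N) x"
        unfolding tr_def M by (simp add: hom.hom_sum hom.hom_add)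
      also have "\<dots> = (\<Sum>k<M. (\<sigma> ^^ Suc k) x) + x" using N(2) by simp
      also have "\<dots> = tr x" unfolding tr_def M by (simp add: sum.lessThan_Suc_shift add.commute
            del: sum.lessThan_Suc)
      finally show "\<sigma> (tr x) = tr x" .
    qed
    then have "\<forall>x. \<exists>c. tr x = \<iota> c" by blast
    then obtain t where t: "\<And>x. tr x = \<iota> (t x)" by (auto dest: choice)
    \<comment> \<open>Equation \<open>N - k\<close>, moved by \<open>\<sigma> ^^ k\<close>, brings
      \<open>b\<close> back to itself. For \<open>k = 0\<close> the index \<open>N\<close> is out of
      range; equation \<open>0\<close> serves, since \<open>\<sigma> ^^ N = id\<close>.\<close>
    have "(\<Sum>b\<in>B. (\<sigma> ^^ k) (y * c b) * b) = 0" if "k < N" for k y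
    proof -
      have "(\<sigma> ^^ k) ((\<sigma> ^^ (N - k)) b) = b" for b
      proof -
        have "(\<sigma> ^^ k) ((\<sigma> ^^ (N - k)) b) = (\<sigma> ^^ (k + (N - k))) b"
          by (simp only: funpow_add comp_apply)
        also have "\<dots> = b" using that N(2) by simp
        finally show ?thesis .
      qed
      then have "(\<sigma> ^^ k) (\<Sum>b\<in>B. (\<sigma> ^^ (N - k)) b * c b) = (\<Sum>b\<in>B. (\<sigma> ^^ k) (c b) * b)"
        by (simp add: pow.hom_sum pow.hom_mult mult.commute)
      moreover have "(\<Sum>b\<in>B. (\<sigma> ^^ (N - k)) b * c b) = 0"
      proof (cases "k = 0")
        case True
        then show ?thesis using bspec[OF c(3), of 0] N by simp
      next
        case False
        then show ?thesis using c(3) N that by simp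
      qed
      ultimately have "(\<Sum>b\<in>B. (\<sigma> ^^ k) (c b) * b) = 0" by simp
      then show ?thesis
        by (simp add: pow.hom_mult mult.assoc sum_distrib_left[symmetric])
    qed
    then have "(\<Sum>b\<in>B. tr (y * c b) * b) = 0" for y
      unfolding tr_def sum_distrib_right by (subst sum.swap) simp
    then have t_zero: "t (y * c b0) = 0" for y
      using indep[of "\<lambda>b. t (y * c b)" b0] c(1) by (simp add: t)
    \<comment> \<open>Every \<open>y\<close> is a multiple of the nonzero \<open>c b0\<close>, so
      the trace vanishes identically.\<close>
    have "\<iota> (t (y / c b0 * c b0)) = \<iota> 0" for y by (simp only: t_zero)
    moreover have "\<iota> 0 = 0"
    proof -
      have "\<iota> 0 + \<iota> 0 = \<iota> 0 + 0"
        using emb unfolding field_embedding_def by (metis add.right_neutral)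
      then show ?thesis by (rule add_left_imp_eq)
    qed
    ultimately have tr_zero: "tr y = 0" for y using c(2) t[of y] by simp
    have "(\<Sum>k<N. 1 * (\<sigma> ^^ k) y) = 0" for y
      using tr_zero[of y] unfolding tr_def by simp
    with dedekind_independence[OF _ inj, of "\<lambda>_. 1" 0] N(1) field_embedding_funpow[OF \<sigma>(1)]
    have "(1 :: 'l) = 0" by blast
    then show False by simp
  qed
  moreover have "N \<le> n" using \<open>\<exists>i>0. i \<le> n \<and> \<sigma> ^^ i = id\<close> least order_trans by blast
  ultimately have "N = n" by simp
  \<comment> \<open>Exponents reduce mod \<open>N\<close>, so those below \<open>N\<close> list the
    group, without repetition by \<open>inj\<close>; the norm becomes an indexed product.\<close>
  have "Gal \<iota> = (\<lambda>i. \<sigma> ^^ i) ` {..<N}"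
  proof -
    have "\<sigma> ^^ i \<in> (\<lambda>i. \<sigma> ^^ i) ` {..<N}" for i
    proof (rule image_eqI)
      show "\<sigma> ^^ i = \<sigma> ^^ (i mod N)"
        by (intro ext funpow_mod_eq[symmetric]) (simp add: N(2))
    qed (use N(1) in simp)
    then show ?thesis unfolding Gal by blast
  qed
  then have "galois_norm \<iota> a = (\<Prod>i<n. (\<sigma> ^^ i) a)" for a
    unfolding galois_norm_def using inj \<open>N = n\<close> by (simp add: prod.reindex)
  with N(2) \<open>N = n\<close> n emb \<sigma>(3) fixed show ?thesis by unfold_locales auto
qed

section \<open>The reduced norm\<close>

text \<open>The index \<open>card A * d\<close> is reached only when every factor contributes its
  coefficient at \<open>d\<close>. As \<open>d\<close> is a mere degree bound, that coefficient may
  be zero.\<close>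

lemma coeff_prod_top:
  fixes p :: "'a \<Rightarrow> 'b::comm_ring_1 poly"
  assumes "finite A" "\<And>i. i \<in> A \<Longrightarrow> degree (p i) \<le> d"
  shows "coeff (\<Prod>i\<in>A. p i) (card A * d) = (\<Prod>i\<in>A. coeff (p i) d)"
  using assms
proof (induction A rule: finite_induct)
  case (insert a A)
  let ?q = "\<Prod>i\<in>A. p i"
  have deg: "degree ?q \<le> card A * d"
    using degree_prod_sum_le[OF insert.hyps(1), of p]
      sum_bounded_above[of A "\<lambda>i. degree (p i)" d] insert.prems
    by (simp add: o_def)
  have "coeff (p a * ?q) (d + card A * d) =
      (\<Sum>i\<le>d + card A * d. if i = d then coeff (p a) d * coeff ?q (card A * d) else 0)"
    unfolding coeff_mult
  proof (rule sum.cong[OF refl])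
    fix i
    show "coeff (p a) i * coeff ?q (d + card A * d - i) =
        (if i = d then coeff (p a) d * coeff ?q (card A * d) else 0)"
      using deg insert.prems[of a]
      by (cases i d rule: linorder_cases) (auto simp: coeff_eq_0)
  qed
  also have "\<dots> = coeff (p a) d * coeff ?q (card A * d)" by simp
  finally show ?case using insert by simp
qed simp

lemma coeff_det_top:
  fixes A :: "'a::comm_ring_1 poly mat"
  assumes A: "A \<in> carrier_mat n n"
    and deg: "\<And>i j. i < n \<Longrightarrow> j < n \<Longrightarrow> degree (A $$ (i, j)) \<le> d"
  shows "coeff (det A) (n * d) = det (map_mat (\<lambda>p. coeff p d) A)"
proof -
  have "coeff (signof \<pi> * (\<Prod>i = 0..<n. A $$ (i, \<pi> i))) (n * d) =
      signof \<pi> * (\<Prod>i = 0..<n. coeff (A $$ (i, \<pi> i)) d)" if "\<pi> permutes {0..<n}" for \<pi>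
  proof -
    have "coeff (\<Prod>i = 0..<n. A $$ (i, \<pi> i)) (card {0..<n} * d) =
        (\<Prod>i = 0..<n. coeff (A $$ (i, \<pi> i)) d)"
      using that by (intro coeff_prod_top deg) (auto simp: permutes_nat_less)
    then show ?thesis by (simp add: sign_def)
  qed
  then show ?thesis
    using A permutes_nat_less
    by (auto simp: det_def' coeff_sum intro!: sum.cong prod.cong)
qed

lemma det_constant_coeff:
  fixes A :: "'a::comm_ring_1 poly mat"
  shows "coeff (det A) 0 = det (map_mat (\<lambda>p. coeff p 0) A)"
proof -
  interpret comm_ring_hom "\<lambda>p :: 'a poly. coeff p 0"
    by unfold_locales (simp_all add: coeff_mult)
  show ?thesis by simp
qed

text \<open>A grading mod \<open>n\<close>: the exponents of \<open>p i\<close> lie in the class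
  \<open>b i - a i\<close>, and classes add under multiplication. Sums replace the differences
  because subtraction on \<open>nat\<close> truncates.\<close>

lemma cong_coeff_prod:
  fixes p :: "'a \<Rightarrow> 'b::comm_semiring_1 poly"
  assumes "finite A"
    and "\<And>i m. i \<in> A \<Longrightarrow> coeff (p i) m \<noteq> 0 \<Longrightarrow> (a i + m) mod n = b i mod n"
    and "coeff (\<Prod>i\<in>A. p i) m \<noteq> 0"
  shows "((\<Sum>i\<in>A. a i) + m) mod n = (\<Sum>i\<in>A. b i) mod (n :: nat)"
  using assms
proof (induction A arbitrary: m rule: finite_induct)
  case empty
  then show ?case by (cases m) auto
next
  case (insert x A)
  then have "(\<Sum>k\<le>m. coeff (p x) k * coeff (\<Prod>i\<in>A. p i) (m - k)) \<noteq> 0"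
    by (simp add: coeff_mult)
  then obtain k where k: "k \<le> m" "coeff (p x) k * coeff (\<Prod>i\<in>A. p i) (m - k) \<noteq> 0"
    by (meson atMost_iff sum.neutral)
  then have "coeff (p x) k \<noteq> 0" "coeff (\<Prod>i\<in>A. p i) (m - k) \<noteq> 0" by auto
  then have "(a x + k) mod n = b x mod n" "((\<Sum>i\<in>A. a i) + (m - k)) mod n = (\<Sum>i\<in>A. b i) mod n"
    using insert by auto
  then have "((a x + k) + ((\<Sum>i\<in>A. a i) + (m - k))) mod n = (b x + (\<Sum>i\<in>A. b i)) mod n"
    by (rule mod_add_cong)
  then show ?case using k(1) insert.hyps by (simp add: algebra_simps)
qed

text \<open>Moving the last \<open>e = d mod n\<close> rows to the top, past the
  \<open>n - e\<close> others, yields the identity matrix and costs the sign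
  \<open>(-1)^((n - e) * e)\<close>.\<close>

lemma det_cyclic_shift:
  assumes "n > 0"
  shows "det (mat n n (\<lambda>(i, j). if (i + d) mod n = j then 1 else 0) :: 'a::comm_ring_1 mat) =
    (- 1) ^ (d * (n - 1))"
proof -
  define e where "e = d mod n"
  have e: "e < n" using assms by (simp add: e_def)
  let ?A = "mat n n (\<lambda>(i, j). if (i + d) mod n = j then 1 else 0) :: 'a mat"
  have shift: "((if i < e then i + (n - e) else i - e) + d) mod n = i" if "i < n" for i
  proof -
    have "((if i < e then i + (n - e) else i - e) + e) mod n = i"
      using e that by auto
    then show ?thesis by (simp only: e_def mod_add_right_eq)
  qed
  have "det ?A = (- 1) ^ ((n - e) * e) *
      det (mat n n (\<lambda>(i, j). ?A $$ (if i < e then i + (n - e)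
        else if i < n - e + e then i - e else i, j)))"
    using e by (intro det_swap_initial_rows) auto
  also have "mat n n (\<lambda>(i, j). ?A $$ (if i < e then i + (n - e)
      else if i < n - e + e then i - e else i, j)) = 1\<^sub>m n"
  proof (rule eq_matI)
    fix i j assume "i < dim_row (1\<^sub>m n :: 'a mat)" "j < dim_col (1\<^sub>m n :: 'a mat)"
    then have "i < n" "j < n" by auto
    then show "mat n n (\<lambda>(i, j). ?A $$ (if i < e then i + (n - e)
        else if i < n - e + e then i - e else i, j)) $$ (i, j) = 1\<^sub>m n $$ (i, j)"
      using e shift[of i] by (auto split: if_splits)
  qed auto
  also have "(- 1 :: 'a) ^ ((n - e) * e) = (- 1) ^ (d * (n - 1))"
  proof -
    \<comment> \<open>\<open>e^2\<close> and \<open>e\<close> have the same parity. Below,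
      \<open>n * (n - 1)\<close> is even, so \<open>d\<close> and its residue \<open>e\<close> give
      the same sign.\<close>
    have "even ((n - e) * e) \<longleftrightarrow> even (e * (n - 1))"
      using e assms by (cases "even e") auto
    also have "\<dots> \<longleftrightarrow> even (d * (n - 1))"
    proof -
      have "even (d * (n - 1)) \<longleftrightarrow> even ((n * (d div n) + e) * (n - 1))"
        by (simp add: e_def)
      also have "\<dots> \<longleftrightarrow> even (e * (n - 1))"
      proof -
        have "even n \<or> even (n - 1)" using assms by auto
        then show ?thesis by (auto simp: distrib_right)
      qed
      finally show ?thesis by simp
    qed
    finally show ?thesis by (simp add: minus_one_power_iff)
  qed
  finally show ?thesis by simp
qed

section \<open>The central subring \<open>K[x^n]\<close> and reduced norms\<close>

context cyclic_extension
begin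

sublocale iota: field_hom \<iota>
proof
  have "\<iota> 0 + \<iota> 0 = \<iota> 0 + 0"
    using iota unfolding field_embedding_def by (metis add.right_neutral)
  then show "\<iota> 0 = 0" by (rule add_left_imp_eq)
qed (use iota in \<open>auto simp: field_embedding_def\<close>)

lemma pow_iota [simp]: "(\<sigma> ^^ i) (\<iota> c) = \<iota> c"
  by (induction i) simp_all

lemma pow_mod: "\<sigma> ^^ (i mod n) = \<sigma> ^^ i"
  by (intro ext funpow_mod_eq) (simp add: sigma_order)

abbreviation subst :: "'k poly \<Rightarrow> 'l poly" where
  "subst \<equiv> subst_xn \<iota> n"

lemma coeff_subst: "coeff (subst F) m = (if n dvd m then \<iota> (coeff F (m div n)) else 0)"
proof -
  have "coeff (subst F) m = (\<Sum>i\<le>degree F. if n * i = m then \<iota> (coeff F i) else 0)"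
    by (simp add: subst_xn_def coeff_sum)
  also have "\<dots> = (\<Sum>i\<le>degree F. if i = m div n then (if n dvd m then \<iota> (coeff F i) else 0) else 0)"
    using n_pos by (intro sum.cong) auto
  also have "\<dots> = (if n dvd m then \<iota> (coeff F (m div n)) else 0)"
    by (auto simp: coeff_eq_0)
  finally show ?thesis .
qed

lemma subst_add: "subst (F + G) = subst F + subst G"
  by (rule poly_eqI) (simp add: coeff_subst iota.hom_add)

lemma subst_smult: "subst (Polynomial.smult c F) = Polynomial.smult (\<iota> c) (subst F)"
  by (rule poly_eqI) (simp add: coeff_subst iota.hom_mult)

lemma subst_const [simp]: "subst [:c:] = [:\<iota> c:]"
  by (simp add: subst_xn_def monom_0)

lemma subst_0 [simp]: "subst 0 = 0"
  using subst_const[of 0] by simp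

lemma subst_1 [simp]: "subst 1 = 1"
  using subst_const[of 1] by (simp add: one_pCons)

lemma subst_pCons_0: "subst (pCons 0 F) = monom 1 n * subst F"
proof (rule poly_eqI)
  fix m
  show "coeff (subst (pCons 0 F)) m = coeff (monom 1 n * subst F) m"
  proof (cases "m < n")
    case True
    then show ?thesis by (auto simp: coeff_subst coeff_monom_mult)
  next
    case False
    then obtain k where "m = n + k" by (auto simp: not_less le_iff_add)
    then show ?thesis using n_pos by (simp add: coeff_subst coeff_monom_mult)
  qed
qed

text \<open>Here \<open>*\<close> is the commutative product of polynomials;
  \<open>skew_mult_subst_left\<close> identifies it with the skew product when the left factor comes
  from \<open>K[y]\<close>.\<close>

lemma subst_mult: "subst (F * G) = subst F * subst G"
proof (induction F)
  case (pCons a F)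
  have "subst (pCons a F) = [:\<iota> a:] + monom 1 n * subst F"
    using subst_add[of "[:a:]" "pCons 0 F"] by (simp add: subst_pCons_0)
  with pCons show ?case
    by (simp add: subst_add subst_smult subst_pCons_0 algebra_simps)
qed simp

lemma subst_power: "subst (F ^ k) = subst F ^ k"
  by (induction k) (simp_all add: subst_mult)

lemma subst_inject [simp]: "subst F = subst G \<longleftrightarrow> F = G"
proof
  assume eq: "subst F = subst G"
  show "F = G"
  proof (rule poly_eqI)
    fix m
    show "coeff F m = coeff G m"
      using arg_cong[OF eq, of "\<lambda>p. coeff p (n * m)"] n_pos by (simp add: coeff_subst)
  qed
qed simp

lemma subst_eq_0_iff [simp]: "subst F = 0 \<longleftrightarrow> F = 0"
  using subst_inject[of F 0] by simp

lemma degree_subst: "degree (subst F) = n * degree F"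
proof (cases "F = 0")
  case False
  show ?thesis
  proof (rule antisym)
    show "degree (subst F) \<le> n * degree F"
      using n_pos by (intro degree_le) (auto simp: coeff_subst dvd_def coeff_eq_0)
    show "n * degree F \<le> degree (subst F)"
      using n_pos False by (intro le_degree) (simp add: coeff_subst)
  qed
qed simp

lemma lead_coeff_subst: "lead_coeff (subst F) = \<iota> (lead_coeff F)"
  using n_pos by (simp add: degree_subst coeff_subst)

lemma coeff_subst_0: "coeff (subst F) 0 = \<iota> (coeff F 0)"
  by (simp add: coeff_subst)

text \<open>Recognises elements of \<open>K[x^n]\<close> by their coefficients, so that reduced
  norms can be pulled back to \<open>K[y]\<close>.\<close>

lemma subst_surj:
  assumes dvd: "\<And>m. coeff p m \<noteq> 0 \<Longrightarrow> n dvd m"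
    and fixed: "\<And>m. coeff p m \<in> range \<iota>"
  shows "p \<in> range subst"
proof -
  define c where "c m = inv_into UNIV \<iota> (coeff p (n * m))" for m
  have c: "\<iota> (c m) = coeff p (n * m)" for m
    unfolding c_def by (rule f_inv_into_f) (rule fixed)
  define G where "G = (\<Sum>i\<le>degree p. monom (c i) i)"
  have "coeff G m = c m" for m
  proof (cases "m \<le> degree p")
    case False
    then have "degree p < n * m" using n_pos by (cases n) auto
    then have "\<iota> (c m) = 0" by (simp add: c coeff_eq_0)
    with False show ?thesis by (simp add: G_def coeff_sum)
  qed (simp add: G_def coeff_sum)
  then have "p = subst G"
    using dvd by (intro poly_eqI) (auto simp: coeff_subst c)
  then show ?thesis by blast
qed

text \<open>Only exponents divisible by \<open>n\<close> occur on the left, and there the twist is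
  trivial because \<open>\<sigma> ^^ n = id\<close>.\<close>

lemma skew_mult_subst_left: "skew_mult \<sigma> (subst G) f = subst G * f"
proof (rule poly_eqI)
  fix m
  show "coeff (skew_mult \<sigma> (subst G) f) m = coeff (subst G * f) m"
    unfolding coeff_skew_mult coeff_mult
  proof (rule sum.cong[OF refl])
    fix i
    show "coeff (subst G) i * (\<sigma> ^^ i) (coeff f (m - i)) = coeff (subst G) i * coeff f (m - i)"
      using pow_mod[of i] by (auto simp: coeff_subst)
  qed
qed

text \<open>Here the twist is trivial because it fixes coefficients from K. Together with the
  previous lemma, \<open>subst G\<close> is central.\<close>

lemma skew_mult_subst_right: "skew_mult \<sigma> f (subst G) = subst G * f"
proof (rule poly_eqI)
  fix m
  have "coeff (skew_mult \<sigma> f (subst G)) m = coeff (f * subst G) m"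
    unfolding coeff_skew_mult coeff_mult
    by (rule sum.cong) (auto simp: coeff_subst)
  then show "coeff (skew_mult \<sigma> f (subst G)) m = coeff (subst G * f) m"
    by (simp add: mult.commute)
qed

text \<open>
  \<open>L[x;\<sigma>]\<close> is free over its commutative subring \<open>L[x\<^sup>n]\<close> with basis \<open>1, x, \<dots>, x\<^bsup>n-1\<^esup>\<close>.
  The matrix below is that of the right multiplication by \<open>f\<close> on this basis, conjugated by
  \<open>diag(1, z, \<dots>, z\<^bsup>n-1\<^esup>)\<close> where \<open>z\<^sup>n = x\<^sup>n\<close>. The conjugation makes all degrees in \<open>z\<close> at most
  the degree of \<open>f\<close>.
\<close>

definition mult_entry :: "'l poly \<Rightarrow> nat \<Rightarrow> nat \<Rightarrow> 'l poly" where
  "mult_entry f i j =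
     (\<Sum>m\<le>degree f. monom (if (i + m) mod n = j then (\<sigma> ^^ i) (coeff f m) else 0) m)"

definition mult_matrix :: "'l poly \<Rightarrow> 'l poly mat" where
  "mult_matrix f = mat n n (\<lambda>(i, j). mult_entry f i j)"

definition reduced_norm :: "'l poly \<Rightarrow> 'l poly" where
  "reduced_norm f = det (mult_matrix f)"

lemma mult_matrix_carrier [simp]: "mult_matrix f \<in> carrier_mat n n"
  by (simp add: mult_matrix_def)

lemma coeff_mult_entry:
  "coeff (mult_entry f i j) m = (if (i + m) mod n = j then (\<sigma> ^^ i) (coeff f m) else 0)"
  by (simp add: mult_entry_def coeff_sum coeff_eq_0)

lemma degree_mult_entry_le: "degree (mult_entry f i j) \<le> degree f"
  by (rule degree_le) (simp add: coeff_mult_entry coeff_eq_0)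

text \<open>Matrix form of \<open>x^i (f g) = (x^i f) g\<close>. For a fixed exponent
  \<open>k\<close> of \<open>f\<close>, only \<open>l = (i + k) mod n\<close> contributes.\<close>

lemma mult_entry_skew_mult:
  "mult_entry (skew_mult \<sigma> f g) i j = (\<Sum>l<n. mult_entry f i l * mult_entry g l j)"
proof (rule poly_eqI)
  fix m
  have entry: "(\<Sum>l<n. coeff (mult_entry f i l) k * coeff (mult_entry g l j) (m - k)) =
      (if (i + m) mod n = j then (\<sigma> ^^ i) (coeff f k * (\<sigma> ^^ k) (coeff g (m - k))) else 0)"
    if "k \<le> m" for k
  proof -
    have "(\<Sum>l<n. coeff (mult_entry f i l) k * coeff (mult_entry g l j) (m - k)) =
        (\<Sum>l<n. if l = (i + k) mod n
           then (\<sigma> ^^ i) (coeff f k) * coeff (mult_entry g ((i + k) mod n) j) (m - k) else 0)"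
      by (rule sum.cong) (auto simp: coeff_mult_entry)
    also have "\<dots> = (\<sigma> ^^ i) (coeff f k) * coeff (mult_entry g ((i + k) mod n) j) (m - k)"
      using n_pos by simp
    also have "\<dots> = (if (i + m) mod n = j
        then (\<sigma> ^^ i) (coeff f k * (\<sigma> ^^ k) (coeff g (m - k))) else 0)"
    proof -
      have "((i + k) mod n + (m - k)) mod n = (i + m) mod n"
        using that mod_add_left_eq[of "i + k" n "m - k"] by simp
      then show ?thesis
        by (simp add: coeff_mult_entry pow_mod funpow_add pow.hom_mult del: add_diff_assoc)
    qed
    finally show ?thesis .
  qed
  have "coeff (\<Sum>l<n. mult_entry f i l * mult_entry g l j) m =
      (\<Sum>k\<le>m. \<Sum>l<n. coeff (mult_entry f i l) k * coeff (mult_entry g l j) (m - k))"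
    unfolding coeff_sum coeff_mult by (rule sum.swap)
  also have "\<dots> = (\<Sum>k\<le>m. if (i + m) mod n = j
      then (\<sigma> ^^ i) (coeff f k * (\<sigma> ^^ k) (coeff g (m - k))) else 0)"
    by (rule sum.cong) (auto simp: entry)
  also have "\<dots> = coeff (mult_entry (skew_mult \<sigma> f g) i j) m"
    by (simp add: coeff_mult_entry coeff_skew_mult pow.hom_sum)
  finally show "coeff (mult_entry (skew_mult \<sigma> f g) i j) m =
      coeff (\<Sum>l<n. mult_entry f i l * mult_entry g l j) m" by simp
qed

lemma reduced_norm_skew_mult:
  "reduced_norm (skew_mult \<sigma> f g) = reduced_norm f * reduced_norm g"
proof -
  have "mult_matrix (skew_mult \<sigma> f g) = mult_matrix f * mult_matrix g"
    by (rule eq_matI)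
      (auto simp: mult_matrix_def mult_entry_skew_mult scalar_prod_def lessThan_atLeast0)
  then show ?thesis
    by (simp add: reduced_norm_def det_mult[of _ n])
qed

lemma reduced_norm_subst: "reduced_norm (subst F) = subst F ^ n"
proof -
  have "mult_matrix (subst F) = subst F \<cdot>\<^sub>m 1\<^sub>m n"
  proof (rule eq_matI)
    fix i j assume "i < dim_row (subst F \<cdot>\<^sub>m 1\<^sub>m n)" "j < dim_col (subst F \<cdot>\<^sub>m 1\<^sub>m n)"
    then have ij: "i < n" "j < n" by auto
    have "mult_entry (subst F) i j = (if i = j then subst F else 0)"
      using ij by (intro poly_eqI) (auto simp: coeff_mult_entry coeff_subst dvd_def)
    then show "mult_matrix (subst F) $$ (i, j) = (subst F \<cdot>\<^sub>m 1\<^sub>m n) $$ (i, j)"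
      using ij by (simp add: mult_matrix_def)
  qed (auto simp: mult_matrix_def)
  then show ?thesis by (simp add: reduced_norm_def)
qed

text \<open>Constant terms sit only on the diagonal, where row \<open>i\<close> carries
  \<open>\<sigma>^i(f_0)\<close>.\<close>

lemma coeff_reduced_norm_0: "coeff (reduced_norm f) 0 = galois_norm \<iota> (coeff f 0)"
proof -
  let ?A = "map_mat (\<lambda>p. coeff p 0) (mult_matrix f)"
  have A: "?A \<in> carrier_mat n n" by simp
  have "upper_triangular ?A"
    by (auto simp: upper_triangular_def mult_matrix_def coeff_mult_entry)
  then have "det ?A = prod_list (diag_mat ?A)" using A by (rule det_upper_triangular)
  also have "\<dots> = (\<Prod>i<n. (\<sigma> ^^ i) (coeff f 0))"
    by (simp add: prod_list_diag_prod mult_matrix_def coeff_mult_entry lessThan_atLeast0)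
  finally show ?thesis
    by (simp add: reduced_norm_def det_constant_coeff galois_norm_eq)
qed

lemma degree_reduced_norm_le: "degree (reduced_norm f) \<le> n * degree f"
  unfolding reduced_norm_def mult.commute[of n]
  by (rule degree_det_le[of n]) (auto simp: mult_matrix_def degree_mult_entry_le)

text \<open>At the top exponent only the leading coefficient \<open>1\<close> survives; powers of
  \<open>\<sigma>\<close> fix it, which leaves a cyclic shift matrix.\<close>

lemma coeff_reduced_norm_top:
  assumes "lead_coeff f = 1"
  shows "coeff (reduced_norm f) (n * degree f) = (- 1) ^ (degree f * (n - 1))"
proof -
  have "coeff (reduced_norm f) (n * degree f) =
      det (map_mat (\<lambda>p. coeff p (degree f)) (mult_matrix f))"
    unfolding reduced_norm_def
    by (rule coeff_det_top) (auto simp: mult_matrix_def degree_mult_entry_le)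
  also have "map_mat (\<lambda>p. coeff p (degree f)) (mult_matrix f) =
      mat n n (\<lambda>(i, j). if (i + degree f) mod n = j then 1 else 0)"
    by (rule eq_matI) (auto simp: mult_matrix_def coeff_mult_entry assms)
  finally show ?thesis by (simp add: det_cyclic_shift n_pos)
qed

lemma degree_reduced_norm:
  assumes "lead_coeff f = 1"
  shows "degree (reduced_norm f) = n * degree f"
  using degree_reduced_norm_le[of f] coeff_reduced_norm_top[OF assms]
  by (intro antisym le_degree) auto

text \<open>Entry \<open>(i, j)\<close> has exponents congruent to \<open>j - i\<close> mod
  \<open>n\<close>, and along a permutation these differences add up to \<open>0\<close>.\<close>

lemma coeff_reduced_norm_dvd:
  assumes "coeff (reduced_norm f) m \<noteq> 0"
  shows "n dvd m"
proof -
  have "coeff (reduced_norm f) m = (\<Sum>\<pi> | \<pi> permutes {0..<n}.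
      coeff (signof \<pi> * (\<Prod>i = 0..<n. mult_matrix f $$ (i, \<pi> i))) m)"
    by (simp add: reduced_norm_def det_def'[of _ n] coeff_sum)
  with assms obtain \<pi> where \<pi>: "\<pi> permutes {0..<n}"
    and nz: "coeff (signof \<pi> * (\<Prod>i = 0..<n. mult_matrix f $$ (i, \<pi> i))) m \<noteq> 0"
    by (metis (mono_tags, lifting) mem_Collect_eq sum.neutral)
  have "coeff (\<Prod>i = 0..<n. mult_matrix f $$ (i, \<pi> i)) m \<noteq> 0"
    using nz by (auto simp: sign_def split: if_splits)
  then have "((\<Sum>i = 0..<n. i) + m) mod n = (\<Sum>i = 0..<n. \<pi> i) mod n"
    by (rule cong_coeff_prod[rotated 2])
      (use \<pi> in \<open>auto simp: mult_matrix_def coeff_mult_entry permutes_nat_less split: if_splits\<close>)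
  also have "(\<Sum>i = 0..<n. \<pi> i) = (\<Sum>i = 0..<n. i)"
    using sum.permute[OF \<pi>, of "\<lambda>i. i"] by (simp add: o_def)
  finally have "[(\<Sum>i = 0..<n. i) + m = (\<Sum>i = 0..<n. i) + 0] (mod n)"
    by (simp add: cong_def)
  then have "[m = 0] (mod n)" by (simp only: cong_add_lcancel_nat)
  then show ?thesis by (simp add: cong_0_iff)
qed

lemma coeff_reduced_norm_fixed: "coeff (reduced_norm f) m \<in> range \<iota>"
  \<comment> \<open>Take reduced norms in \<open>x f = f\<^sup>\<sigma> x\<close>, where \<open>f\<^sup>\<sigma>\<close> has the coefficients \<open>\<sigma>(f\<^sub>i)\<close>.\<close>
proof -
  interpret map_poly_comm_ring_hom \<sigma> by unfold_locales
  let ?x = "monom 1 1 :: 'l poly"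
  have "map_mat (map_poly \<sigma>) (mult_matrix f) = mult_matrix (map_poly \<sigma> f)"
    by (rule eq_matI)
      (auto simp: mult_matrix_def coeff_mult_entry coeff_map_poly funpow_swap1 intro!: poly_eqI)
  then have \<sigma>: "map_poly \<sigma> (reduced_norm f) = reduced_norm (map_poly \<sigma> f)"
    by (metis hom_det reduced_norm_def)
  have "skew_mult \<sigma> ?x f = skew_mult \<sigma> (map_poly \<sigma> f) ?x"
  proof (rule poly_eqI)
    fix k
    have "coeff (skew_mult \<sigma> ?x f) k = (\<Sum>i\<le>k. if i = 1 then \<sigma> (coeff f (k - 1)) else 0)"
      unfolding coeff_skew_mult by (rule sum.cong) auto
    \<comment> \<open>At \<open>k = 0\<close> the truncated \<open>k - 1\<close> is \<open>0\<close>
      as well, yet the term there is \<open>0\<close> because \<open>x\<close> has no constant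
      term.\<close>
    moreover have "coeff (skew_mult \<sigma> (map_poly \<sigma> f) ?x) k =
        (\<Sum>i\<le>k. if i = k - 1 then if k = 0 then 0 else \<sigma> (coeff f (k - 1)) else 0)"
      unfolding coeff_skew_mult by (rule sum.cong) (auto simp: coeff_map_poly)
    ultimately show "coeff (skew_mult \<sigma> ?x f) k = coeff (skew_mult \<sigma> (map_poly \<sigma> f) ?x) k"
      by (auto simp: not_le)
  qed
  then have "reduced_norm ?x * reduced_norm f = map_poly \<sigma> (reduced_norm f) * reduced_norm ?x"
    by (simp add: \<sigma> flip: reduced_norm_skew_mult)
  \<comment> \<open>The norm of \<open>x\<close> has a sign as its top coefficient, so it can be
    cancelled in the integral domain of polynomials.\<close>
  moreover have "reduced_norm ?x \<noteq> 0"
    using coeff_reduced_norm_top[of ?x] by (auto simp: degree_monom_eq)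
  ultimately have "map_poly \<sigma> (reduced_norm f) = reduced_norm f"
    by (simp add: mult.commute)
  then have "\<sigma> (coeff (reduced_norm f) m) = coeff (reduced_norm f) m"
    by (metis coeff_map_poly hom.hom_zero)
  then show ?thesis by (rule sigma_fixedD)
qed

end

section \<open>Divisors and bounds\<close>

text \<open>Induction on \<open>N\<close>: the prime \<open>F\<close> divides \<open>G\<close> or
  \<open>H\<close> and is cancelled there.\<close>

lemma dvd_irreducible_power_poly:
  fixes F :: "'k::field poly"
  assumes "irreducible F" "G * H = F ^ N"
  shows "\<exists>c k. G = Polynomial.smult c (F ^ k)"
  using assms(2)
proof (induction N arbitrary: G H)
  case 0
  then have "G dvd 1" by (auto simp: dvd_def intro: exI[of _ H] dest: sym)
  then obtain c where "G = [:c:]" using is_unit_poly_iff by blast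
  then have "G = Polynomial.smult c (F ^ 0)" by simp
  then show ?case by blast
next
  case (Suc N)
  have F: "prime_elem F" "F \<noteq> 0"
    using assms(1) field_poly_irreducible_imp_prime by auto
  have "F dvd G * H" using Suc.prems by simp
  then consider G' where "G = F * G'" | H' where "H = F * H'"
    using F(1) by (metis dvd_def prime_elem_dvd_mult_iff)
  then show ?case
  proof cases
    case 1
    with Suc.prems F(2) have "G' * H = F ^ N" by (simp add: mult.assoc)
    from Suc.IH[OF this] obtain c k where "G' = Polynomial.smult c (F ^ k)" by blast
    then have "G = Polynomial.smult c (F ^ Suc k)" using 1 by simp
    then show ?thesis by blast
  next
    case 2
    with Suc.prems F(2) have "G * H' = F ^ N" by (simp add: mult.left_commute)
    from Suc.IH[OF this] show ?thesis .
  qed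
qed

section \<open>Irreducible elements and maximal left ideals\<close>

context twisted_field
begin

text \<open>The left ideal spanned by \<open>g\<close> and \<open>f\<close> is generated by an
  element \<open>d\<close> of least degree. As \<open>f\<close> is a left multiple of
  \<open>d\<close>, irreducibility makes \<open>d\<close> a unit or an associate of
  \<open>f\<close>.\<close>

lemma skew_irreducible_comaximal:
  assumes irr: "skew_irreducible \<sigma> f" and g: "g \<notin> range (\<lambda>r. skew_mult \<sigma> r f)"
  shows "\<exists>a b. skew_mult \<sigma> a g + skew_mult \<sigma> b f = 1"
proof -
  define I where "I = {skew_mult \<sigma> a g + skew_mult \<sigma> b f | a b. True}"
  have I_f: "f \<in> I" unfolding I_def by (intro CollectI exI[of _ 0] exI[of _ 1]) simp
  have I_g: "g \<in> I" unfolding I_def by (intro CollectI exI[of _ 1] exI[of _ 0]) simp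
  \<comment> \<open>This closure property keeps the remainder of a division between elements of
    \<open>I\<close> inside \<open>I\<close>.\<close>
  have I_diff: "x - skew_mult \<sigma> q y \<in> I" if "x \<in> I" "y \<in> I" for x y q
  proof -
    from that obtain a b a' b' where
      "x = skew_mult \<sigma> a g + skew_mult \<sigma> b f" "y = skew_mult \<sigma> a' g + skew_mult \<sigma> b' f"
      by (auto simp: I_def)
    then have "x - skew_mult \<sigma> q y = skew_mult \<sigma> (a - skew_mult \<sigma> q a') g
        + skew_mult \<sigma> (b - skew_mult \<sigma> q b') f"
      by (simp add: skew_mult_add_right skew_mult_diff_left skew_mult_assoc)
    then show ?thesis unfolding I_def by blast
  qed
  have f0: "f \<noteq> 0" using irr by (simp add: skew_irreducible_def)
  obtain d where d: "d \<in> I" "d \<noteq> 0"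
    and min: "\<And>y. y \<in> I \<Longrightarrow> y \<noteq> 0 \<Longrightarrow> degree d \<le> degree y"
    using ex_has_least_nat[of "\<lambda>y. y \<in> I \<and> y \<noteq> 0" f degree] I_f f0 by blast
  have gen: "\<exists>q. x = skew_mult \<sigma> q d" if "x \<in> I" for x
  proof -
    obtain q r where qr: "x = skew_mult \<sigma> q d + r" "r = 0 \<or> degree r < degree d"
      using skew_division[OF d(2)] by blast
    have "r \<in> I" using I_diff[OF that d(1), of q] qr(1) by simp
    then have "r = 0" using min[of r] qr(2) by force
    with qr(1) show ?thesis by auto
  qed
  obtain q where q: "f = skew_mult \<sigma> q d" using gen[OF I_f] by blast
  then consider "q \<in> Units (skew_ring \<sigma>)" | "d \<in> Units (skew_ring \<sigma>)"
    using irr unfolding skew_irreducible_def by blast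
  then show ?thesis
  proof cases
    \<comment> \<open>Here \<open>d\<close> is a left multiple of \<open>f\<close>, so
      \<open>g\<close> would be one too.\<close>
    case 1
    then obtain u where "skew_mult \<sigma> u q = 1" by (auto simp: Units_def skew_ring_def)
    then have "d = skew_mult \<sigma> u f" by (simp add: q flip: skew_mult_assoc)
    moreover obtain p where "g = skew_mult \<sigma> p d" using gen[OF I_g] by blast
    ultimately have "g = skew_mult \<sigma> (skew_mult \<sigma> p u) f" by (simp add: skew_mult_assoc)
    with g show ?thesis by blast
  next
    case 2
    then obtain u where u: "skew_mult \<sigma> u d = 1" by (auto simp: Units_def skew_ring_def)
    obtain a b where "d = skew_mult \<sigma> a g + skew_mult \<sigma> b f" using d(1) by (auto simp: I_def)
    with u have "skew_mult \<sigma> (skew_mult \<sigma> u a) g + skew_mult \<sigma> (skew_mult \<sigma> u b) f = 1"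
      by (simp add: skew_mult_add_right skew_mult_assoc)
    then show ?thesis by blast
  qed
qed

end

section \<open>Norms of divisors and irreducibility of bounds\<close>

context cyclic_extension
begin

lemma galois_norm_of_divisor:
  assumes irr: "irreducible F" "lead_coeff F = 1"
    and g: "lead_coeff g = 1" "skew_divisor \<sigma> g (subst F)"
    and deg: "degree g = degree F * k"
  shows "galois_norm \<iota> (coeff g 0) =
    (- 1) ^ (degree F * k * (n - 1)) * coeff (subst F) 0 ^ k"
proof -
  let ?N = reduced_norm
  obtain q where "subst F = skew_mult \<sigma> q g \<or> subst F = skew_mult \<sigma> g q"
    using g(2) by (auto simp: skew_divisor_def)
  \<comment> \<open>Reduced norms commute, so left and right divisors give the same
    equation.\<close>
  then have prod: "?N g * ?N q = subst F ^ n"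
    by (metis reduced_norm_skew_mult reduced_norm_subst mult.commute)
  \<comment> \<open>The equation descends to \<open>K[y]\<close>, where \<open>F\<close> is
    irreducible; over L it may factor.\<close>
  have "?N f \<in> range subst" for f
    by (intro subst_surj coeff_reduced_norm_dvd coeff_reduced_norm_fixed)
  then obtain G H where G: "?N g = subst G" and H: "?N q = subst H" by blast
  have "G * H = F ^ n"
    using prod by (simp add: G H flip: subst_mult subst_power)
  then obtain c k' where G': "G = Polynomial.smult c (F ^ k')"
    using dvd_irreducible_power_poly[OF irr(1)] by blast
  have F: "F \<noteq> 0" using irr by auto
  have degF: "degree F > 0"
    using irr(1) F by (metis irreducible_def is_unit_iff_degree not_gr_zero)
  have degN: "degree (?N g) = n * degree g"
    by (rule degree_reduced_norm[OF g(1)])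
  have top: "lead_coeff (?N g) = (- 1) ^ (degree F * k * (n - 1))"
    using coeff_reduced_norm_top[OF g(1)] by (simp add: degN deg)
  then have c: "c \<noteq> 0" using G G' by auto
  have "n * degree G = n * (degree F * k)"
    using degN by (simp add: G degree_subst deg)
  then have "degree F * k' = degree F * k"
    using n_pos c by (simp add: G' degree_power_eq F mult.commute)
  then have "k' = k" using degF by simp
  \<comment> \<open>\<open>F\<close> is monic, so the leading coefficient of \<open>G\<close> is
    \<open>c\<close>; that of the reduced norm is the sign of a cyclic shift.\<close>
  have "\<iota> c = (- 1) ^ (degree F * k * (n - 1))"
    using top by (simp only: G lead_coeff_subst G' lead_coeff_smult lead_coeff_power irr(2)) simp
  moreover have "galois_norm \<iota> (coeff g 0) = \<iota> (c * coeff F 0 ^ k)"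
    unfolding coeff_reduced_norm_0[symmetric] G coeff_subst_0
    by (simp add: G' \<open>k' = k\<close> coeff_0_power)
  ultimately show ?thesis
    by (simp add: coeff_subst_0 iota.hom_mult iota.hom_power)
qed

text \<open>Centrality of \<open>subst H\<close> lets a factor on its right be moved to its
  left.\<close>

lemma subst_ideal: "ideal (range (\<lambda>r. skew_mult \<sigma> r (subst H))) (skew_ring \<sigma>)"
proof (rule idealI[OF ring_skew_ring])
  let ?R = "skew_ring \<sigma>" and ?I = "range (\<lambda>r. skew_mult \<sigma> r (subst H))"
  interpret ring ?R by (rule ring_skew_ring)
  show "subgroup ?I (add_monoid ?R)"
  proof (rule add.subgroupI)
    show "\<ominus>\<^bsub>?R\<^esub> a \<in> ?I" if a: "a \<in> ?I" for a
    proof -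
      have "\<ominus>\<^bsub>?R\<^esub> a = - a"
        by (rule minus_equality) (simp_all add: skew_ring_def)
      moreover have "- a \<in> ?I"
        using a by (auto simp flip: skew_mult_uminus_left)
      ultimately show ?thesis by simp
    qed
    show "a \<oplus>\<^bsub>?R\<^esub> b \<in> ?I" if "a \<in> ?I" "b \<in> ?I" for a b
      using that by (auto simp: skew_ring_def simp flip: skew_mult_add_left)
  qed (auto simp: skew_ring_def)
  show "x \<otimes>\<^bsub>?R\<^esub> a \<in> ?I" if "a \<in> ?I" for a x
    using that by (auto simp: skew_ring_def simp flip: skew_mult_assoc)
  show "a \<otimes>\<^bsub>?R\<^esub> x \<in> ?I" if "a \<in> ?I" for a x
  proof -
    from that obtain r where "a = skew_mult \<sigma> r (subst H)" by blast
    moreover have "skew_mult \<sigma> (subst H) x = skew_mult \<sigma> x (subst H)"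
      by (simp only: skew_mult_subst_left skew_mult_subst_right)
    ultimately have "skew_mult \<sigma> a x = skew_mult \<sigma> (skew_mult \<sigma> r x) (subst H)"
      by (simp only: skew_mult_assoc)
    then show ?thesis by (auto simp: skew_ring_def)
  qed
qed

text \<open>Turns the bound into divisibility in \<open>K[y]\<close>: the left ideal generated by
  \<open>subst H\<close> is two-sided, so once it lies in \<open>Rf\<close> it lies in the largest
  such ideal, which \<open>subst F\<close> generates.\<close>

lemma
  assumes "is_bound \<iota> \<sigma> n f F"
  shows bound_monic: "lead_coeff F = 1"
    and bound_mem: "subst F \<in> range (\<lambda>r. skew_mult \<sigma> r f)"
    and bound_dvd: "subst H \<in> range (\<lambda>r. skew_mult \<sigma> r f) \<Longrightarrow> F dvd H"
proof -
  let ?R = "skew_ring \<sigma>" and ?Rf = "range (\<lambda>r. skew_mult \<sigma> r f)"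
  let ?I = "\<lambda>H. range (\<lambda>r. skew_mult \<sigma> r (subst H))"
  define J where "J = genideal ?R {subst F}"
  have J: "J \<subseteq> ?Rf" "\<And>I. ideal I ?R \<Longrightarrow> I \<subseteq> ?Rf \<Longrightarrow> I \<subseteq> J" and "lead_coeff F = 1"
    using assms by (auto simp: is_bound_def Let_def J_def)
  then show "lead_coeff F = 1" by simp
  have mem: "subst H \<in> ?I H" for H by (rule range_eqI[of _ _ 1]) simp
  have "subst F \<in> J" by (auto simp: J_def genideal_def)
  with J(1) show "subst F \<in> ?Rf" by blast
  assume "subst H \<in> ?Rf"
  then obtain r where r: "subst H = skew_mult \<sigma> r f" by blast
  have "skew_mult \<sigma> p (subst H) = skew_mult \<sigma> (skew_mult \<sigma> p r) f" for p
    by (simp add: r skew_mult_assoc)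
  then have "?I H \<subseteq> ?Rf" by auto
  then have "?I H \<subseteq> J" by (intro J(2) subst_ideal)
  with mem have "subst H \<in> J" by (rule rev_subsetD)
  also have "J \<subseteq> ?I F" using subst_ideal[of F] mem[of F] by (auto simp: J_def genideal_def)
  finally obtain p where "subst H = p * subst F"
    by (auto simp: skew_mult_subst_right mult.commute)
  \<comment> \<open>The cofactor \<open>p\<close> is only known over L. Divisibility is brought down
    to \<open>K[y]\<close> by comparing the degree of the remainder with that of
    \<open>F\<close>.\<close>
  then have "subst (H mod F) = (p - subst (H div F)) * subst F"
  proof -
    have "subst H = subst (H div F) * subst F + subst (H mod F)"
      by (simp flip: subst_mult subst_add)
    with \<open>subst H = p * subst F\<close> show ?thesis by (simp add: algebra_simps)
  qed
  moreover have "H mod F = 0 \<or> degree (H mod F) < degree F"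
    using \<open>lead_coeff F = 1\<close> by (intro degree_mod_less) auto
  moreover have "H mod F = 0" if "degree (H mod F) < degree F"
  proof (rule ccontr)
    assume "H mod F \<noteq> 0"
    with calculation(1) have "p - subst (H div F) \<noteq> 0" "subst F \<noteq> 0"
      by (metis mult_zero_left subst_eq_0_iff, metis mult_zero_right subst_eq_0_iff)
    then have "degree (subst F) \<le> degree (subst (H mod F))"
      unfolding calculation(1) by (simp add: degree_mult_eq)
    with that n_pos show False by (simp add: degree_subst)
  qed
  ultimately have "H mod F = 0" by blast
  then show "F dvd H" by (simp add: mod_eq_0_iff_dvd)
qed

text \<open>If \<open>subst H\<close> is outside \<open>Rf\<close>, write \<open>1\<close> as a left
  combination of \<open>subst H\<close> and \<open>f\<close> and multiply by the central
  \<open>subst G\<close>; this puts \<open>subst G\<close> into \<open>Rf\<close>. So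
  \<open>F\<close> divides one of its two factors, and the other is a unit.\<close>

lemma bound_irreducible:
  assumes lead: "lead_coeff f = 1" and irr: "skew_irreducible \<sigma> f"
    and bound: "is_bound \<iota> \<sigma> n f F"
  shows "irreducible F"
proof (rule irreducibleI)
  let ?Rf = "range (\<lambda>r. skew_mult \<sigma> r f)"
  show F0: "F \<noteq> 0" using bound_monic[OF bound] by auto
  have f1: "f \<noteq> 1"
    using irr skew_unitI[of 1] by (auto simp: skew_irreducible_def one_pCons)
  obtain r where r: "subst F = skew_mult \<sigma> r f" using bound_mem[OF bound] by blast
  show "\<not> F dvd 1"
  proof
    \<comment> \<open>A constant bound would force the monic \<open>f\<close> to be
      \<open>1\<close>, a unit.\<close>
    assume "F dvd 1"
    then have "degree F = 0" using F0 by (simp add: is_unit_iff_degree)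
    moreover have "r \<noteq> 0" "f \<noteq> 0" using r F0 by auto
    ultimately have "degree f = 0"
      using degree_subst[of F] degree_skew_mult[of r f] r by simp
    with lead f1 show False by (auto elim!: degree_eq_zeroE simp: one_pCons)
  qed
  fix G H assume GH: "F = G * H"
  have "subst G \<in> ?Rf \<or> subst H \<in> ?Rf"
  proof (rule disjCI)
    assume "subst H \<notin> ?Rf"
    then obtain a b where "skew_mult \<sigma> a (subst H) + skew_mult \<sigma> b f = 1"
      using skew_irreducible_comaximal[OF irr] by blast
    then have "skew_mult \<sigma> (subst G) (skew_mult \<sigma> a (subst H) + skew_mult \<sigma> b f) = subst G"
      by simp
    moreover have "skew_mult \<sigma> (subst G) (skew_mult \<sigma> a (subst H)) = skew_mult \<sigma> a (subst F)"
      unfolding skew_mult_subst_left skew_mult_subst_right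
      by (simp add: GH subst_mult mult.assoc)
    ultimately have "subst G =
        skew_mult \<sigma> (skew_mult \<sigma> a r + skew_mult \<sigma> (subst G) b) f"
      by (simp add: skew_mult_add_left skew_mult_add_right skew_mult_assoc r)
    then show "subst G \<in> ?Rf" by blast
  qed
  then have "F dvd G \<or> F dvd H" using bound_dvd[OF bound] by blast
  then show "G dvd 1 \<or> H dvd 1"
    using F0 unfolding GH by auto
qed

end

text \<open>Both parts are instances of \<open>galois_norm_of_divisor\<close>: (a) with
  \<open>k = l\<close>, as the bound is a left multiple of \<open>f\<close>, and (b) with
  \<open>k = h * l\<close>.\<close>

theorem mainTheorem2:
  fixes \<iota> :: "'k::field \<Rightarrow> 'l::field" and \<sigma> :: "'l \<Rightarrow> 'l" and n :: nat
  assumes "n \<ge> 2"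
    and "cyclic_galois_extension \<iota> \<sigma> n"
  shows
    "(\<forall>(f :: 'l poly) (F :: 'k poly) s l.
        lead_coeff f = 1 \<and> skew_irreducible \<sigma> f \<and> coeff f 0 \<noteq> 0 \<and>
        is_bound \<iota> \<sigma> n f F \<and> degree F = s \<and>
        l = ell \<iota> \<sigma> n F \<and> degree f = s * l \<longrightarrow>
        galois_norm \<iota> (coeff f 0) =
          (-1) ^ (s * l * (n - 1)) * coeff (subst_xn \<iota> n F) 0 ^ l)
     \<and>
     (\<forall>(F :: 'k poly) (g :: 'l poly) s l m h.
        lead_coeff F = 1 \<and> irreducible F \<and> degree F = s \<and> F \<noteq> [:0, 1:] \<and>
        lead_coeff g = 1 \<and> skew_divisor \<sigma> g (subst_xn \<iota> n F) \<and>
        l = ell \<iota> \<sigma> n F \<and> m = num_factors \<iota> \<sigma> n F \<and>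
        h \<in> {1..m} \<and> degree g = s * h * l \<longrightarrow>
        galois_norm \<iota> (coeff g 0) =
          (-1) ^ (s * h * l * (n - 1)) * coeff (subst_xn \<iota> n F) 0 ^ (h * l))"
proof (intro conjI allI impI; elim conjE)
  interpret cyclic_extension \<iota> \<sigma> n
    using assms(2) by (rule cyclic_extensionI)
  fix f :: "'l poly" and F :: "'k poly" and s l
  assume f: "lead_coeff f = 1" "skew_irreducible \<sigma> f" and bound: "is_bound \<iota> \<sigma> n f F"
    and deg: "degree F = s" "degree f = s * l"
  have "skew_divisor \<sigma> f (subst_xn \<iota> n F)"
    using bound_mem[OF bound] by (auto simp: skew_divisor_def)
  from galois_norm_of_divisor[OF bound_irreducible[OF f bound] bound_monic[OF bound] f(1) this, of l]
  show "galois_norm \<iota> (coeff f 0) =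
      (-1) ^ (s * l * (n - 1)) * coeff (subst_xn \<iota> n F) 0 ^ l"
    using deg by simp
next
  interpret cyclic_extension \<iota> \<sigma> n
    using assms(2) by (rule cyclic_extensionI)
  fix F :: "'k poly" and g :: "'l poly" and s l m h
  assume "irreducible F" "lead_coeff F = 1" "lead_coeff g = 1"
    and "skew_divisor \<sigma> g (subst_xn \<iota> n F)" "degree F = s" "degree g = s * h * l"
  then show "galois_norm \<iota> (coeff g 0) =
      (-1) ^ (s * h * l * (n - 1)) * coeff (subst_xn \<iota> n F) 0 ^ (h * l)"
    using galois_norm_of_divisor[of F g "h * l"] by (simp add: mult.assoc)
qed

end
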